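(* Let $\triangle ABC$ be a triangle. If $P$ is on the circumcircle of $\triangle ABC$, then the conic $\mathcal{Y}^*$ through the six vertices of the P-ellipses of $\triangle ABC$ with respect to $P$ is degenerate (two straight lines).
   Context: Given a triangle $\triangle ABC$ and a point $P$, the P-ellipses $\mathcal{E}_a^*,\mathcal{E}_b^*,\mathcal{E}_c^*$ are the ellipses with foci on $(B,C)$, $(C,A)$, $(A,B)$, respectively, passing through $P$. The vertices of an ellipse are its two intersections with its focal axis (the line through the foci). The six vertices of the three P-ellipses lie on a conic, denoted $\mathcal{Y}^*$. *)

theory Defs
  imports "HOL-Analysis.Analysis"
begin

definition P_ellipse :: "real^2 \<Rightarrow> real^2 \<Rightarrow> real^2 \<Rightarrow> (real^2) set" where
  "P_ellipse F G P = {X. dist X F + dist X G = dist P F + dist P G}"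

text \<open>When \<open>P\<close> lies on the segment \<open>FG\<close>, the locus above collapses to that segment, so that its
  intersection with the focal axis is no longer a pair of points; its endpoints are then taken
  as the (limiting) vertices.  For \<open>P\<close> on the circumcircle of a triangle this happens
  only when \<open>P\<close> is a corner of the triangle.\<close>

definition P_ellipse_vertices :: "real^2 \<Rightarrow> real^2 \<Rightarrow> real^2 \<Rightarrow> (real^2) set" where
  "P_ellipse_vertices F G P =
     (if P \<in> closed_segment F G then {F, G} else P_ellipse F G P \<inter> affine hull {F, G})"

definition six_vertices :: "real^2 \<Rightarrow> real^2 \<Rightarrow> real^2 \<Rightarrow> real^2 \<Rightarrow> (real^2) set" where
  "six_vertices A B C P =
     P_ellipse_vertices B C P \<union> P_ellipse_vertices C A P \<union> P_ellipse_vertices A B P"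

definition homog :: "real^2 \<Rightarrow> real^3" where
  "homog X = vector [X$1, X$2, 1]"

text \<open>A conic is given by the symmetric matrix of its equation in homogeneous coordinates.  The
  last conjunct says that the affine equation has degree exactly two.\<close>

definition conic_matrix :: "real^3^3 \<Rightarrow> bool" where
  "conic_matrix M \<longleftrightarrow> transpose M = M \<and> \<not> (M$1$1 = 0 \<and> M$1$2 = 0 \<and> M$2$2 = 0)"

definition conic_curve :: "real^3^3 \<Rightarrow> (real^2) set" where
  "conic_curve M = {X. homog X \<bullet> (M *v homog X) = 0}"

definition degenerate_conic :: "real^3^3 \<Rightarrow> bool" where
  "degenerate_conic M \<longleftrightarrow> det M = 0"

definition straight_line :: "(real^2) set \<Rightarrow> bool" where
  "straight_line L \<longleftrightarrow> affine L \<and> aff_dim L = 1"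

end

theory Submission
  imports Defs
begin

text \<open>Label the triangle so that \<open>P\<close> and \<open>A\<close> are opposite corners of the cyclic quadrilateral
  \<open>ABPC\<close>.  The vertices on \<open>BC\<close> divide it in the ratios determined by
  \<open>\<plusminus>(PB + PC) / BC\<close>, and similarly for the other sides.  Ptolemy's two theorems (for the product
  and for the ratio of the diagonals) give exactly Menelaus' condition for one choice of
  vertices, one on each side line; by symmetry about the midpoints of the sides the three
  remaining vertices are collinear as well.  So the six vertices lie on two lines.  Conversely, a conic
  through three distinct collinear points contains their line; if it also has a point off that line,
  its equation factors into two different linear ones.  This argument also covers the case that \<open>P\<close> is
  a corner of the triangle, where the conic through the vertices is not unique.\<close>

section \<open>Signed areas and affine coordinates in the plane\<close>

definition cross2 :: "real^2 \<Rightarrow> real^2 \<Rightarrow> real" where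
  "cross2 u v = u$1 * v$2 - u$2 * v$1"

lemma mem_affine_hull_2_iff_cross2:
  assumes "Y \<noteq> Z"
  shows "X \<in> affine hull {Y, Z} \<longleftrightarrow> cross2 (Z - Y) (X - Y) = 0"
proof
  assume "X \<in> affine hull {Y, Z}"
  then show "cross2 (Z - Y) (X - Y) = 0"
    by (auto simp: affine_hull_2_alt cross2_def)
next
  assume c: "cross2 (Z - Y) (X - Y) = 0"
  have "\<exists>t. X = Y + t *\<^sub>R (Z - Y)"
  proof (cases "Z$1 = Y$1")
    case True
    then have "Z$2 \<noteq> Y$2"
      using assms by (auto simp: vec_eq_iff forall_2)
    with True c have "X = Y + ((X$2 - Y$2) / (Z$2 - Y$2)) *\<^sub>R (Z - Y)"
      by (simp add: vec_eq_iff forall_2 cross2_def)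
    then show ?thesis ..
  next
    case False
    moreover from False c have "X$2 - Y$2 = (X$1 - Y$1) * (Z$2 - Y$2) / (Z$1 - Y$1)"
      by (simp add: cross2_def nonzero_eq_divide_eq mult.commute)
    ultimately have "X = Y + ((X$1 - Y$1) / (Z$1 - Y$1)) *\<^sub>R (Z - Y)"
      by (simp add: vec_eq_iff forall_2)
    then show ?thesis ..
  qed
  then show "X \<in> affine hull {Y, Z}"
    by (auto simp: affine_hull_2_alt)
qed

lemma collinear_iff_cross2:
  "collinear {A, B, C} \<longleftrightarrow> cross2 (B - A) (C - A) = 0"
proof (cases "A = B")
  case True
  then show ?thesis by (simp add: cross2_def)
next
  case False
  then show ?thesis
    by (simp add: collinear_3_affine_hull mem_affine_hull_2_iff_cross2)
qed

text \<open>Cramer's rule: cleared of its denominator it is a polynomial identity in the entries. It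
  supplies the oblique coordinates in which conics are analysed below.\<close>

lemma cross2_coordinates:
  assumes "cross2 z w \<noteq> 0"
  shows "X = (cross2 X w / cross2 z w) *\<^sub>R z + (cross2 z X / cross2 z w) *\<^sub>R w"
proof -
  have "cross2 z w *\<^sub>R X = cross2 X w *\<^sub>R z + cross2 z X *\<^sub>R w"
    by (simp add: vec_eq_iff forall_2 cross2_def algebra_simps)
  then have "(1 / cross2 z w) *\<^sub>R (cross2 z w *\<^sub>R X) =
      (1 / cross2 z w) *\<^sub>R (cross2 X w *\<^sub>R z + cross2 z X *\<^sub>R w)"
    by (rule arg_cong)
  then show ?thesis
    using assms by (simp add: scaleR_right_distrib)
qed

lemma cross2_independent:
  assumes "cross2 z w \<noteq> 0" "x *\<^sub>R z + y *\<^sub>R w = 0"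
  shows "x = 0" "y = 0"
proof -
  have "cross2 (x *\<^sub>R z + y *\<^sub>R w) w = x * cross2 z w"
    "cross2 z (x *\<^sub>R z + y *\<^sub>R w) = y * cross2 z w"
    by (simp_all add: cross2_def algebra_simps)
  then show "x = 0" "y = 0"
    using assms by (auto simp: cross2_def)
qed

section \<open>Conics and pairs of lines\<close>

lemma straight_line_affine_hull_2: "Y \<noteq> Z \<Longrightarrow> straight_line (affine hull {Y, Z})"
  by (simp add: straight_line_def aff_dim_affine_hull aff_dim_2)

text \<open>The product of the equations of the two lines is quadratic; \<open>M\<close> is the
  symmetrised outer product of their coefficient vectors. Its part of degree two is a product of two
  nonzero linear forms, hence nonzero.\<close>

lemma conic_through_two_lines:
  assumes "Y \<noteq> Z" "Y' \<noteq> Z'"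
  shows "\<exists>M. conic_matrix M \<and> affine hull {Y, Z} \<union> affine hull {Y', Z'} \<subseteq> conic_curve M"
proof -
  define l :: "real^2 \<Rightarrow> real^2 \<Rightarrow> real^3"
    where "l = (\<lambda>Y Z. vector [Y$2 - Z$2, Z$1 - Y$1, (Z$2 - Y$2) * Y$1 - (Z$1 - Y$1) * Y$2])"
  have l: "l Y Z \<bullet> homog X = cross2 (Z - Y) (X - Y)" for X Y Z
    by (simp add: l_def homog_def inner_vec_def sum_3 cross2_def algebra_simps)
  define n n' where "n = l Y Z" and "n' = l Y' Z'"
  define M :: "real^3^3" where "M = (\<chi> i j. n$i * n'$j + n'$i * n$j)"
  have nz: "n$1 \<noteq> 0 \<or> n$2 \<noteq> 0" "n'$1 \<noteq> 0 \<or> n'$2 \<noteq> 0"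
    using assms by (auto simp: n_def n'_def l_def vec_eq_iff forall_2)
  have "transpose M = M"
    by (simp add: M_def transpose_def vec_eq_iff algebra_simps)
  moreover have "\<not> (M$1$1 = 0 \<and> M$1$2 = 0 \<and> M$2$2 = 0)"
    using nz by (auto simp: M_def)
  moreover have "homog X \<bullet> (M *v homog X) = 2 * ((n \<bullet> homog X) * (n' \<bullet> homog X))" for X
    by (simp add: M_def inner_vec_def matrix_vector_mult_def sum_3 algebra_simps)
  ultimately show ?thesis
    using assms
    by (intro exI[of _ M])
      (auto simp: conic_matrix_def conic_curve_def n_def n'_def l mem_affine_hull_2_iff_cross2)
qed

lemma quadratic_three_roots:
  fixes f g h k :: real
  assumes "\<And>t. t \<in> {0, 1, k} \<Longrightarrow> f + g * t + h * t\<^sup>2 = 0" "k \<noteq> 0" "k \<noteq> 1"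
  shows "f = 0" "g = 0" "h = 0"
proof -
  show f: "f = 0" using assms(1)[of 0] by simp
  have gh: "g + h = 0" using assms(1)[of 1] f by simp
  have "k * (g + h * k) = 0"
    using assms(1)[of k] f by (simp add: power2_eq_square algebra_simps)
  then have "g + h * k = 0" using assms by simp
  with gh have "h * (k - 1) = 0" by algebra
  then show "h = 0" using assms by simp
  with gh show "g = 0" by simp
qed

text \<open>Take \<open>Y\<close> as origin and \<open>Z - Y\<close>, \<open>D - Y\<close> as axes,
  with coordinates (x, y). On y = 0 the equation has degree at most two and three roots, so it
  vanishes there and y divides it. The cofactor is linear and vanishes at \<open>D\<close>, the
  point (0, 1); its line differs from \<open>YZ\<close> because it contains
  \<open>D\<close>.\<close>

lemma conic_with_three_collinear_points:
  assumes M: "conic_matrix M" and YZ: "Y \<noteq> Z" and k: "k \<noteq> 0" "k \<noteq> 1"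
    and on: "Y \<in> conic_curve M" "Z \<in> conic_curve M" "Y + k *\<^sub>R (Z - Y) \<in> conic_curve M"
    and D: "D \<in> conic_curve M" "D \<notin> affine hull {Y, Z}"
  shows "degenerate_conic M \<and>
    (\<exists>L1 L2. straight_line L1 \<and> straight_line L2 \<and> L1 \<noteq> L2 \<and> conic_curve M = L1 \<union> L2)"
proof -
  define z w where "z = Z - Y" and "w = D - Y"
  have zw: "cross2 z w \<noteq> 0"
    using D YZ by (simp add: z_def w_def mem_affine_hull_2_iff_cross2)
  define h where "h = homog Y"
  \<comment> \<open>Directions carry the third coordinate 0, so that adding them to \<open>h\<close>
    gives again the homogeneous vector of a point.\<close>
  define z' :: "real^3" where "z' = vector [z$1, z$2, 0]"
  define w' :: "real^3" where "w' = vector [w$1, w$2, 0]"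
  define b where "b u v = u \<bullet> (M *v v)" for u v
  have sym: "b u v = b v u" for u v
    using M unfolding b_def conic_matrix_def
    by (metis dot_lmul_matrix inner_commute transpose_matrix_vector)
  have blin: "b (u + u') v = b u v + b u' v" "b u (v + v') = b u v + b u v'"
    "b (t *\<^sub>R u) v = t * b u v" "b u (t *\<^sub>R v) = t * b u v" for u u' v v' t
    by (simp_all add: b_def inner_add_left inner_add_right matrix_vector_right_distrib
        matrix_vector_mult_scaleR)
  have homog: "homog (Y + x *\<^sub>R z + y *\<^sub>R w) = h + x *\<^sub>R z' + y *\<^sub>R w'" for x y
    by (simp add: homog_def h_def z'_def w'_def vec_eq_iff forall_3)
  have curve: "Y + x *\<^sub>R z + y *\<^sub>R w \<in> conic_curve M \<longleftrightarrow>
      b h h + 2 * b h z' * x + b z' z' * x\<^sup>2 + y * (2 * b z' w' * x + b w' w' * y + 2 * b h w') = 0"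
    for x y
    unfolding conic_curve_def mem_Collect_eq homog b_def[symmetric]
    by (simp add: blin sym[of z' h] sym[of w' h] sym[of w' z'] power2_eq_square algebra_simps)
  have "b h h + 2 * b h z' * t + b z' z' * t\<^sup>2 = 0" if "t \<in> {0, 1, k}" for t
    using that on curve[of t 0] by (auto simp: z_def)
  from quadratic_three_roots[OF this k]
  have b0: "b h h = 0" "b h z' = 0" "b z' z' = 0" by auto
  define e g where "e = 2 * b z' w'" and "g = b w' w'"
  \<comment> \<open>\<open>D\<close> has coordinates (0, 1); its equation eliminates
    \<open>b h w'\<close>.\<close>
  have hw: "2 * b h w' = - g"
    using curve[of 0 1] D by (simp add: b0 w_def g_def)
  have curve': "Y + x *\<^sub>R z + y *\<^sub>R w \<in> conic_curve M \<longleftrightarrow> y * (e * x + g * (y - 1)) = 0" for x y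
    unfolding curve b0 hw by (simp add: e_def g_def algebra_simps)
  \<comment> \<open>\<open>b z' z'\<close> is already 0. If \<open>e\<close> and \<open>g\<close>
    were 0 as well, \<open>b\<close> would vanish on all pairs of directions, and the equation would
    have no part of degree two.\<close>
  have eg: "e \<noteq> 0 \<or> g \<noteq> 0"
  proof (rule ccontr)
    assume "\<not> ?thesis"
    then have 0: "b z' w' = 0" "b w' w' = 0" by (auto simp: e_def g_def)
    have "b (vector [X$1, X$2, 0]) (vector [V$1, V$2, 0]) = 0" for X V :: "real^2"
    proof -
      have "\<exists>x y. vector [X$1, X$2, 0] = x *\<^sub>R z' + y *\<^sub>R w'" for X :: "real^2"
      proof -
        obtain x y where "X = x *\<^sub>R z + y *\<^sub>R w"
          using cross2_coordinates[OF zw] by blast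
        then have "vector [X$1, X$2, 0] = x *\<^sub>R z' + y *\<^sub>R w'"
          by (simp add: z'_def w'_def vec_eq_iff forall_3)
        then show ?thesis by blast
      qed
      then obtain x y x2 y2 where "vector [X$1, X$2, 0] = x *\<^sub>R z' + y *\<^sub>R w'"
        "vector [V$1, V$2, 0] = x2 *\<^sub>R z' + y2 *\<^sub>R w'"
        by meson
      then show ?thesis by (simp add: blin b0 0 sym[of w' z'])
    qed
    from this[of "vector [1, 0]" "vector [1, 0]"] this[of "vector [1, 0]" "vector [0, 1]"]
      this[of "vector [0, 1]" "vector [0, 1]"]
    have "M$1$1 = 0 \<and> M$1$2 = 0 \<and> M$2$2 = 0"
      by (simp add: b_def inner_vec_def matrix_vector_mult_def sum_3)
    then show False using M by (simp add: conic_matrix_def)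
  qed

  \<comment> \<open>In the coordinates \<open>(x, y)\<close> the two lines meet at \<open>(g / e, 0)\<close>, the kernel of \<open>M\<close>.\<close>
  define v where "v = e *\<^sub>R h + g *\<^sub>R z'"
  have "b u v = 0" for u
  proof -
    have 1: "b h v = 0" "b z' v = 0" "b w' v = 0"
    proof -
      have "b w' v = e * b h w' + g * b z' w'"
        by (simp add: v_def blin sym[of w' h] sym[of w' z'])
      also have "\<dots> = 0"
        using hw e_def by algebra
      finally show "b w' v = 0" .
    qed (simp_all add: v_def blin b0 sym[of z' h])
    \<comment> \<open>Subtracting \<open>u$3\<close> times \<open>h\<close> from \<open>u\<close>
      leaves a direction, so \<open>h\<close>, \<open>z'\<close>, \<open>w'\<close> span the space
      and it suffices to test \<open>v\<close> against them.\<close>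
    obtain x y where xy: "vector [u$1, u$2] - u$3 *\<^sub>R Y = x *\<^sub>R z + y *\<^sub>R w"
      using cross2_coordinates[OF zw] by blast
    then have "u = u$3 *\<^sub>R h + x *\<^sub>R z' + y *\<^sub>R w'"
      by (simp add: h_def homog_def z'_def w'_def vec_eq_iff forall_3 forall_2 algebra_simps)
    then have "b u v = b (u$3 *\<^sub>R h + x *\<^sub>R z' + y *\<^sub>R w') v" by simp
    then show ?thesis by (simp add: blin 1)
  qed
  then have "M *v v = 0"
    unfolding b_def by (metis inner_eq_zero_iff)
  \<comment> \<open>The third entry of \<open>v\<close> is \<open>e\<close>. If it is 0, the two
    lines are parallel and \<open>v\<close> is their common point at infinity, a nonzero multiple of
    \<open>z'\<close>.\<close>
  moreover have "v \<noteq> 0"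
  proof
    assume v: "v = 0"
    then have "v$3 = 0" by simp
    then have "e = 0" by (simp add: v_def h_def homog_def z'_def)
    with v eg have "z' = 0" by (simp add: v_def)
    then have "z'$1 = 0 \<and> z'$2 = 0" by simp
    then show False using zw by (simp add: z'_def cross2_def)
  qed
  ultimately have det: "det M = 0"
    using invertible_det_nz matrix_left_invertible_ker invertible_left_inverse by metis

  \<comment> \<open>The line e x + g (y - 1) = 0 passes through (0, 1) with direction (g,
    -e).\<close>
  define d where "d = g *\<^sub>R z - e *\<^sub>R w"
  have d: "d \<noteq> 0"
    using cross2_independent[OF zw, of g "- e"] eg by (auto simp: d_def)
  define L where "L = affine hull {D, D + d}"
  have L: "L = range (\<lambda>t. Y + (t * g) *\<^sub>R z + (1 - t * e) *\<^sub>R w)"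
    unfolding L_def affine_hull_2_alt d_def w_def by (simp add: algebra_simps)
  have "X \<in> conic_curve M \<longleftrightarrow> X \<in> affine hull {Y, Z} \<union> L" for X
  proof -
    obtain x y where "X - Y = x *\<^sub>R z + y *\<^sub>R w"
      using cross2_coordinates[OF zw] by blast
    then have X: "X = Y + x *\<^sub>R z + y *\<^sub>R w" by (simp add: algebra_simps)
    have "X \<in> affine hull {Y, Z} \<longleftrightarrow> y = 0"
      using zw by (simp add: mem_affine_hull_2_iff_cross2[OF YZ] X z_def[symmetric])
        (simp add: cross2_def algebra_simps)
    moreover have "X \<in> L \<longleftrightarrow> e * x + g * (y - 1) = 0"
    proof
      assume "X \<in> L"
      then obtain t where "X = Y + (t * g) *\<^sub>R z + (1 - t * e) *\<^sub>R w" by (auto simp: L)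
      then have "(x - t * g) *\<^sub>R z + (y - (1 - t * e)) *\<^sub>R w = 0"
        by (simp add: X algebra_simps)
      from cross2_independent[OF zw this] have "x = t * g" "y = 1 - t * e" by auto
      then show "e * x + g * (y - 1) = 0" by simp
    next
      assume 0: "e * x + g * (y - 1) = 0"
      have "\<exists>t. x = t * g \<and> y = 1 - t * e"
      proof (cases "e = 0")
        case True
        then show ?thesis using 0 eg by (intro exI[of _ "x / g"]) auto
      next
        case False
        then show ?thesis using 0
          by (intro exI[of _ "(1 - y) / e"]) (simp add: field_simps)
      qed
      then show "X \<in> L" by (auto simp: L X)
    qed
    ultimately show ?thesis using curve' by (auto simp: X)
  qed
  then have "conic_curve M = affine hull {Y, Z} \<union> L" by blast
  moreover have "D \<in> L" by (simp add: L_def hull_inc)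
  ultimately show ?thesis
    using det D YZ d straight_line_affine_hull_2[of Y Z] straight_line_affine_hull_2[of D "D + d"]
    unfolding degenerate_conic_def L_def by (metis add_cancel_left_right)
qed

section \<open>Vertices of a P-ellipse on its focal axis\<close>

lemma closed_segment_sphere:
  fixes F G P Q :: "'a::euclidean_space"
  assumes "P \<in> closed_segment F G" "{F, G, P} \<subseteq> sphere Q r"
  shows "P = F \<or> P = G"
  using assms dist_decreases_open_segment[of P F G Q]
  by (auto simp: open_segment_def)

definition vertex :: "real^2 \<Rightarrow> real^2 \<Rightarrow> real \<Rightarrow> real^2" where
  "vertex F G t = F + t *\<^sub>R (G - F)"

text \<open>At parameter \<open>s\<close> on the axis the distances to the foci add up to |s| + |1 -
  s| times \<open>dist F G\<close>. With m the distance sum at \<open>P\<close> divided by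
  \<open>dist F G\<close>, the equation |s| + |1 - s| = m has the solutions (1 + m) / 2 and (1 - m)
  / 2 when m > 1. For \<open>P\<close> at a focus m = 1, and the parameters 1 and 0 give the
  limiting vertices.\<close>

lemma P_ellipse_vertices_eq:
  assumes FG: "F \<noteq> G" and circle: "{F, G, P} \<subseteq> sphere Q r"
  defines "t \<equiv> (1 + (dist P F + dist P G) / dist F G) / 2"
  shows "P_ellipse_vertices F G P = {vertex F G t, vertex F G (1 - t)}"
proof (cases "P \<in> closed_segment F G")
  case True
  then have "P = F \<or> P = G" using circle by (rule closed_segment_sphere)
  then have "t = 1" using FG by (auto simp: t_def dist_commute)
  then show ?thesis using True by (auto simp: P_ellipse_vertices_def vertex_def)
next
  case False
  define m where "m = (dist P F + dist P G) / dist F G"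
  have "dist F G \<noteq> dist F P + dist P G"
    using False between between_mem_segment by metis
  then have "dist P F + dist P G > dist F G"
    using dist_triangle[of F G P] by (simp add: dist_commute)
  then have m: "m > 1" using FG by (simp add: m_def)
  have t: "t = (1 + m) / 2" by (simp add: t_def m_def)
  have "F + s *\<^sub>R (G - F) \<in> P_ellipse F G P \<longleftrightarrow> s = t \<or> s = 1 - t" for s
  proof -
    have "(F + s *\<^sub>R (G - F)) - G = (1 - s) *\<^sub>R (F - G)" by (simp add: algebra_simps)
    then have 1: "dist (F + s *\<^sub>R (G - F)) G = \<bar>1 - s\<bar> * dist F G"
      by (simp add: dist_norm)
    have 2: "dist (F + s *\<^sub>R (G - F)) F = \<bar>s\<bar> * dist F G"
      by (simp add: dist_norm norm_minus_commute)
    have "F + s *\<^sub>R (G - F) \<in> P_ellipse F G P \<longleftrightarrow> \<bar>s\<bar> + \<bar>1 - s\<bar> = m"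
      using FG unfolding P_ellipse_def mem_Collect_eq 1 2 m_def
      by (simp add: field_simps)
    also have "\<dots> \<longleftrightarrow> s = t \<or> s = 1 - t"
      using m by (auto simp: t abs_if field_simps)
    finally show ?thesis .
  qed
  then have "P_ellipse F G P \<inter> affine hull {F, G} = {vertex F G t, vertex F G (1 - t)}"
    by (auto simp: affine_hull_2_alt vertex_def)
  then show ?thesis using False by (simp add: P_ellipse_vertices_def)
qed

lemma P_ellipse_vertices_commute: "P_ellipse_vertices F G P = P_ellipse_vertices G F P"
  unfolding P_ellipse_vertices_def P_ellipse_def
  by (simp only: closed_segment_commute[of F G] insert_commute[of F G] add.commute[of "dist _ F"])

section \<open>Menelaus' condition and Ptolemy's theorems\<close>

text \<open>The first assumption is Menelaus' condition, product of the ratios s / (1 - s) equal to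
  -1, cleared of denominators so that vertices at corners are included. The points on
  \<open>CA\<close> and \<open>AB\<close> have barycentric \<open>A\<close>-coordinates
  \<open>t\<close> and \<open>1 - u\<close>; the coefficient makes that of the combination vanish,
  and the condition then matches the \<open>B\<close>-coordinates.\<close>

lemma menelaus_vertices:
  assumes "s * t * u + (1 - s) * (1 - t) * (1 - u) = 0" "1 - t - u \<noteq> 0"
  shows "vertex B C s =
    vertex C A t + (- t / (1 - t - u)) *\<^sub>R (vertex A B u - vertex C A t)"
proof -
  have divide: "x = y + (- t / w) * d" if "w \<noteq> 0" "w * x = w * y - t * d" for x y d w :: real
    using that by (simp add: field_simps)
  have "(1 - t - u) * (B$i + s * (C$i - B$i)) = (1 - t - u) * (C$i + t * (A$i - C$i))
     - t * (A$i + u * (B$i - A$i) - (C$i + t * (A$i - C$i)))" for i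
    using assms(1) by algebra
  from divide[OF assms(2) this] show ?thesis
    by (simp add: vertex_def vec_eq_iff)
qed

text \<open>The Menelaus expression is the ratio of the signed areas of the inscribed triangle and
  of \<open>ABC\<close>; a nonzero value shows that three vertices are not collinear.\<close>

lemma cross2_vertices:
  "cross2 (vertex A B u - vertex C A t) (vertex B C s - vertex C A t) =
     (s * t * u + (1 - s) * (1 - t) * (1 - u)) * cross2 (B - A) (C - A)"
  by (simp add: cross2_def vertex_def algebra_simps)

text \<open>Here \<open>a\<close>, \<open>b\<close>, \<open>c\<close> are the sides and
  \<open>p\<close>, \<open>q\<close>, \<open>s\<close> the distances from \<open>P\<close> to
  \<open>A\<close>, \<open>B\<close>, \<open>C\<close>. The conclusion is Menelaus' condition for
  the parameters \<open>x\<close>, \<open>1 - y\<close>, \<open>1 - z\<close> and at the same time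
  for \<open>1 - x\<close>, \<open>y\<close>, \<open>z\<close>.\<close>

lemma ptolemy_vertices_menelaus:
  fixes a b c p q s :: real
  assumes nz: "a \<noteq> 0" "b \<noteq> 0" "c \<noteq> 0"
    and ptolemy: "p * a = q * b + s * c" "p * (c * q + b * s) = a * (b * c + q * s)"
  defines "x \<equiv> (1 + (q + s) / a) / 2" and "y \<equiv> (1 + (s + p) / b) / 2"
    and "z \<equiv> (1 + (p + q) / c) / 2"
  shows "x * (1 - y) * (1 - z) + (1 - x) * y * z = 0"
proof -
  have e: "2 * a * x = a + (q + s)" "2 * b * y = b + (s + p)" "2 * c * z = c + (p + q)"
    using nz by (simp_all add: x_def y_def z_def field_simps)
  have "8 * a * b * c * (x * (1 - y) * (1 - z) + (1 - x) * y * z) =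
      (2 * a * x) * (2 * b - 2 * b * y) * (2 * c - 2 * c * z)
      + (2 * a - 2 * a * x) * (2 * b * y) * (2 * c * z)"
    by (simp add: algebra_simps)
  \<comment> \<open>Half of this is a (b c + (s + p) (p + q)) - (q + s) (b (p + q) + c (s + p)). The
    two relations give a (b c + q s) + a p^2 = p (q + s) (b + c), and the first gives a p (q + s) =
    (q + s) (q b + s c).\<close>
  also have "\<dots> = 0"
    unfolding e using ptolemy by algebra
  finally show ?thesis using nz by simp
qed

section \<open>The two lines through the six vertices\<close>

text \<open>A property of the vertex set alone, so that relabelling the corners becomes a rewriting
  of \<open>six_vertices\<close>.\<close>

abbreviation only_line_pairs :: "(real^2) set \<Rightarrow> bool" where
  "only_line_pairs S \<equiv> (\<exists>M. conic_matrix M \<and> S \<subseteq> conic_curve M) \<and>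
    (\<forall>M. conic_matrix M \<and> S \<subseteq> conic_curve M \<longrightarrow>
       degenerate_conic M \<and>
       (\<exists>L1 L2. straight_line L1 \<and> straight_line L2 \<and> L1 \<noteq> L2 \<and> conic_curve M = L1 \<union> L2))"

text \<open>By \<open>ptolemy_vertices_menelaus\<close> the vertices with parameters
  \<open>x\<close>, \<open>1 - y\<close>, \<open>1 - z\<close> lie on one line and those with
  \<open>1 - x\<close>, \<open>y\<close>, \<open>z\<close> on another. The first three are distinct
  and the vertex at \<open>1 - x\<close> is off their line, so
  \<open>conic_with_three_collinear_points\<close> applies to every conic through the six.\<close>

lemma only_line_pairs_six_vertices:
  assumes triangle: "\<not> collinear {A, B, C}"
    and circle: "{A, B, C, P} \<subseteq> sphere Q r"
    and P: "P \<noteq> A" "P \<noteq> C"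
    and ptolemy: "dist P A * dist B C = dist P B * dist C A + dist P C * dist A B"
      "dist P A * (dist A B * dist P B + dist C A * dist P C) =
        dist B C * (dist C A * dist A B + dist P B * dist P C)"
  shows "only_line_pairs (six_vertices A B C P)"
proof -
  have ne: "A \<noteq> B" "B \<noteq> C" "C \<noteq> A"
    using triangle by (auto simp: insert_commute)
  define x where "x = (1 + (dist P B + dist P C) / dist B C) / 2"
  define y where "y = (1 + (dist P C + dist P A) / dist C A) / 2"
  define z where "z = (1 + (dist P A + dist P B) / dist A B) / 2"
  have S: "six_vertices A B C P = {vertex B C x, vertex B C (1 - x)} \<union>
      {vertex C A y, vertex C A (1 - y)} \<union> {vertex A B z, vertex A B (1 - z)}"
    unfolding six_vertices_def x_def y_def z_def
    using ne circle by (simp add: P_ellipse_vertices_eq[of _ _ _ Q r])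
  have menelaus: "x * (1 - y) * (1 - z) + (1 - x) * y * z = 0"
    unfolding x_def y_def z_def
    using ptolemy_vertices_menelaus[OF _ _ _ ptolemy] ne by simp
  have xz: "x \<ge> 1" "z \<ge> 1"
    using ne dist_triangle[of B C P] dist_triangle[of A B P]
    by (simp_all add: x_def z_def dist_commute)
  \<comment> \<open>Excluding \<open>A\<close> and \<open>C\<close> keeps \<open>P\<close> off this
    segment, which makes the bound on \<open>y\<close> strict; for \<open>P\<close> at
    \<open>B\<close> both \<open>x\<close> and \<open>z\<close> are 1.\<close>
  have "P \<notin> closed_segment C A"
    using closed_segment_sphere[of P C A Q r] circle P by auto
  then have "dist C A \<noteq> dist C P + dist P A"
    using between between_mem_segment by metis
  then have y: "y > 1"
    using ne dist_triangle[of C A P] by (simp add: y_def dist_commute)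

  define Y Z where "Y = vertex C A (1 - y)" and "Z = vertex A B (1 - z)"
  define k where "k = - (1 - y) / (1 - (1 - y) - (1 - z))"
  \<comment> \<open>\<open>k\<close> is (y - 1) / (y + z - 1), strictly between 0 and 1.\<close>
  have k: "k \<noteq> 0" "k \<noteq> 1" using xz y by (auto simp: k_def field_simps)
  have X: "vertex B C x = Y + k *\<^sub>R (Z - Y)"
    unfolding Y_def Z_def k_def using menelaus xz y by (intro menelaus_vertices) auto
  have D: "cross2 (Z - Y) (vertex B C (1 - x) - Y) \<noteq> 0"
  proof -
    \<comment> \<open>Menelaus' equation replaces x (1 - y) (1 - z) by -(1 - x) y z, leaving (x^2 -
      (1 - x)^2) y z.\<close>
    have "x * ((1 - x) * (1 - y) * (1 - z) + x * y * z) = (2 * x - 1) * y * z"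
      using menelaus by algebra
    also have "\<dots> > 0" using xz y by simp
    finally have "(1 - x) * (1 - y) * (1 - z) + x * y * z \<noteq> 0" by auto
    then show ?thesis
      using triangle unfolding Y_def Z_def cross2_vertices collinear_iff_cross2 by simp
  qed
  then have YZ: "Y \<noteq> Z" by (auto simp: cross2_def)

  define Y' Z' where "Y' = vertex C A y" and "Z' = vertex A B z"
  have "vertex B C (1 - x) = Y' + (- y / (1 - y - z)) *\<^sub>R (Z' - Y')"
    unfolding Y'_def Z'_def using menelaus xz y
    by (intro menelaus_vertices) (auto simp: algebra_simps)
  then have X': "vertex B C (1 - x) \<in> affine hull {Y', Z'}"
    unfolding affine_hull_2_alt by blast
  \<comment> \<open>\<open>Z'\<close> lies on the line \<open>AB\<close>, while \<open>Y'\<close>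
    does not because \<open>y\<close> is not 1.\<close>
  have "cross2 (B - A) (Y' - A) = (1 - y) * cross2 (B - A) (C - A)"
    "cross2 (B - A) (Z' - A) = 0"
    by (simp_all add: Y'_def Z'_def vertex_def cross2_def algebra_simps)
  then have "Y' \<noteq> Z'"
    using triangle y by (auto simp: collinear_iff_cross2)
  with YZ obtain M where "conic_matrix M"
    "affine hull {Y, Z} \<union> affine hull {Y', Z'} \<subseteq> conic_curve M"
    using conic_through_two_lines by blast
  moreover have "six_vertices A B C P \<subseteq> affine hull {Y, Z} \<union> affine hull {Y', Z'}"
  proof -
    have "vertex B C x \<in> affine hull {Y, Z}"
      unfolding X affine_hull_2_alt by blast
    moreover have "{Y, Z} \<subseteq> affine hull {Y, Z}" "{Y', Z'} \<subseteq> affine hull {Y', Z'}"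
      by (rule hull_subset)+
    ultimately show ?thesis
      unfolding S using X' by (auto simp: Y_def Z_def Y'_def Z'_def)
  qed
  ultimately have "\<exists>M. conic_matrix M \<and> six_vertices A B C P \<subseteq> conic_curve M" by blast
  moreover have "\<forall>M. conic_matrix M \<and> six_vertices A B C P \<subseteq> conic_curve M \<longrightarrow>
    degenerate_conic M \<and>
    (\<exists>L1 L2. straight_line L1 \<and> straight_line L2 \<and> L1 \<noteq> L2 \<and> conic_curve M = L1 \<union> L2)"
  proof (intro allI impI, elim conjE)
    fix M
    assume M: "conic_matrix M" "six_vertices A B C P \<subseteq> conic_curve M"
    then have "Y \<in> conic_curve M" "Z \<in> conic_curve M" "Y + k *\<^sub>R (Z - Y) \<in> conic_curve M"
      "vertex B C (1 - x) \<in> conic_curve M"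
      unfolding X[symmetric] by (simp_all add: S Y_def Z_def)
    moreover have "vertex B C (1 - x) \<notin> affine hull {Y, Z}"
      using D YZ by (simp add: mem_affine_hull_2_iff_cross2)
    ultimately show "degenerate_conic M \<and>
        (\<exists>L1 L2. straight_line L1 \<and> straight_line L2 \<and> L1 \<noteq> L2 \<and> conic_curve M = L1 \<union> L2)"
      by (rule conic_with_three_collinear_points[OF M(1) YZ k])
  qed
  ultimately show ?thesis by (rule conjI)
qed

section \<open>Chords and inscribed angles\<close>

definition circle_point :: "real^2 \<Rightarrow> real \<Rightarrow> real \<Rightarrow> real^2" where
  "circle_point Q r \<theta> = Q + r *\<^sub>R vector [cos \<theta>, sin \<theta>]"

text \<open>The law of cosines at the centre gives r^2 (2 - 2 cos) of the central angle for the
  squared chord, and the half-angle formula takes the root. The parameters are doubled so that their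
  differences are inscribed angles.\<close>

lemma dist_circle_point:
  assumes "r \<ge> 0"
  shows "dist (circle_point Q r (\<theta> + 2 * x)) (circle_point Q r (\<theta> + 2 * y)) = 2 * r * \<bar>sin (x - y)\<bar>"
proof -
  define s t where "s = \<theta> + 2 * x" and "t = \<theta> + 2 * y"
  have "(dist (circle_point Q r s) (circle_point Q r t))\<^sup>2 =
      (r * cos s - r * cos t)\<^sup>2 + (r * sin s - r * sin t)\<^sup>2"
    by (simp add: circle_point_def dist_vec_def L2_set_def sum_2 dist_real_def)
  also have "\<dots> = r\<^sup>2 * ((sin s)\<^sup>2 + (cos s)\<^sup>2 + ((sin t)\<^sup>2 + (cos t)\<^sup>2)
      - 2 * (cos s * cos t + sin s * sin t))"
    by algebra
  also have "\<dots> = r\<^sup>2 * (2 - 2 * cos (s - t))"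
    by (simp add: cos_diff)
  also have "s - t = 2 * (x - y)"
    by (simp add: s_def t_def)
  also have "r\<^sup>2 * (2 - 2 * cos (2 * (x - y))) = (2 * r * \<bar>sin (x - y)\<bar>)\<^sup>2"
    unfolding cos_double_sin by (simp add: power_mult_distrib)
  finally show ?thesis
    using assms unfolding s_def t_def by (simp add: power2_eq_iff_nonneg)
qed

lemma sphere_circle_point:
  assumes X: "X \<in> sphere Q r" and r: "r > 0"
  obtains x where "0 \<le> x" "x < pi" "X = circle_point Q r (\<theta> + 2 * x)"
proof -
  define u v where "u = (X$1 - Q$1) / r" and "v = (X$2 - Q$2) / r"
  have "(X$1 - Q$1)\<^sup>2 + (X$2 - Q$2)\<^sup>2 = r\<^sup>2"
    using X by (auto simp: dist_vec_def L2_set_def sum_2 dist_real_def power2_commute)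
  then have uv: "u\<^sup>2 + v\<^sup>2 = 1"
    using r by (simp add: u_def v_def power_divide flip: add_divide_distrib)
  \<comment> \<open>Rotation by -\<theta> keeps (u, v) on the unit circle, so the remaining angle
    \<open>t\<close> can be taken in [0, 2 pi) whatever the base direction.\<close>
  have "(cos \<theta> * u + sin \<theta> * v)\<^sup>2 + (cos \<theta> * v - sin \<theta> * u)\<^sup>2
     = ((sin \<theta>)\<^sup>2 + (cos \<theta>)\<^sup>2) * (u\<^sup>2 + v\<^sup>2)"
    by algebra
  then have "(cos \<theta> * u + sin \<theta> * v)\<^sup>2 + (cos \<theta> * v - sin \<theta> * u)\<^sup>2 = 1"
    using uv by simp
  then obtain t where t: "0 \<le> t" "t < 2 * pi"
    "cos \<theta> * u + sin \<theta> * v = cos t" "cos \<theta> * v - sin \<theta> * u = sin t"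
    using sincos_total_2pi by metis
  have "u = cos (\<theta> + t)" "v = sin (\<theta> + t)"
    unfolding cos_add sin_add t(3,4)[symmetric]
    using sin_cos_squared_add[of \<theta>] by algebra+
  then have "X = circle_point Q r (\<theta> + 2 * (t / 2))"
    using r by (simp add: circle_point_def vec_eq_iff forall_2 u_def v_def field_simps)
  then show ?thesis using that[of "t / 2"] t by simp
qed

text \<open>Distances on the circle are 2 r times sines, so these are Ptolemy's two theorems for
  \<open>ABPC\<close> with the powers of 2 r removed.\<close>

lemma ptolemy_sin:
  fixes \<alpha> \<beta> \<gamma> :: real
  shows "sin \<alpha> * sin (\<gamma> - \<beta>) = sin \<beta> * sin (\<gamma> - \<alpha>) + sin \<gamma> * sin (\<alpha> - \<beta>)" (is ?A)
    and "sin \<alpha> * (sin (\<alpha> - \<beta>) * sin \<beta> + sin (\<gamma> - \<alpha>) * sin \<gamma>) =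
      sin (\<gamma> - \<beta>) * (sin (\<gamma> - \<alpha>) * sin (\<alpha> - \<beta>) + sin \<beta> * sin \<gamma>)" (is ?B)
proof -
  show ?A
    unfolding sin_diff by algebra
  \<comment> \<open>Two of the eight terms cancel. After cos^2 = 1 - sin^2 the other six combine
    into terms sin cos of one angle times a difference of squared sines of the other two, as does
    the rest of the claim.\<close>
  have "sin (\<gamma> - \<beta>) * (sin (\<gamma> - \<alpha>) * sin (\<alpha> - \<beta>)) =
      sin \<alpha> * cos \<alpha> * (sin \<gamma>)\<^sup>2 * (cos \<beta>)\<^sup>2 - sin \<beta> * cos \<beta> * (sin \<gamma>)\<^sup>2 * (cos \<alpha>)\<^sup>2
      - sin \<gamma> * cos \<gamma> * (sin \<alpha>)\<^sup>2 * (cos \<beta>)\<^sup>2 + sin \<gamma> * cos \<gamma> * (sin \<beta>)\<^sup>2 * (cos \<alpha>)\<^sup>2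
      + sin \<beta> * cos \<beta> * (sin \<alpha>)\<^sup>2 * (cos \<gamma>)\<^sup>2 - sin \<alpha> * cos \<alpha> * (sin \<beta>)\<^sup>2 * (cos \<gamma>)\<^sup>2"
    unfolding sin_diff by (simp add: algebra_simps power2_eq_square)
  then show ?B
    unfolding distrib_left[of "sin (\<gamma> - \<beta>)"] cos_squared_eq
    by (simp add: sin_diff algebra_simps power2_eq_square)
qed

text \<open>\<open>\<alpha>\<close>, \<open>\<beta>\<close>, \<open>\<gamma>\<close> are the inscribed angles over the chords \<open>PA\<close>, \<open>PB\<close>, \<open>PC\<close>.
  Since only \<open>\<beta> = 0\<close> is allowed, \<open>P\<close> may coincide with \<open>B\<close>, but not with \<open>A\<close> or \<open>C\<close>.\<close>

lemma only_line_pairs_ordered: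
  assumes triangle: "\<not> collinear {A, B, C}" and r: "r > 0"
    and A: "A = circle_point Q r (\<theta> + 2 * \<alpha>)" and B: "B = circle_point Q r (\<theta> + 2 * \<beta>)"
    and C: "C = circle_point Q r (\<theta> + 2 * \<gamma>)" and P: "P = circle_point Q r \<theta>"
    and order: "0 \<le> \<beta>" "\<beta> < \<alpha>" "\<alpha> < \<gamma>" "\<gamma> < pi"
  shows "only_line_pairs (six_vertices A B C P)"
proof (rule only_line_pairs_six_vertices[OF triangle])
  have "circle_point Q r t \<in> sphere Q r" for t
    using r by (simp add: circle_point_def dist_norm norm_vec_def L2_set_def sum_2
        power_mult_distrib flip: distrib_left)
  then show "{A, B, C, P} \<subseteq> sphere Q r" by (simp add: A B C P)
  \<comment> \<open>The differences lie in [0, pi), where the sine is nonnegative: here the order of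
    the points fixes the signs in Ptolemy's theorems.\<close>
  have dist: "dist (circle_point Q r (\<theta> + 2 * x)) (circle_point Q r (\<theta> + 2 * y)) = 2 * r * sin (y - x)"
    if "0 \<le> x" "x \<le> y" "y < pi" for x y
  proof -
    have "sin (y - x) \<ge> 0" using that by (intro sin_ge_zero) auto
    then show ?thesis
      using r by (simp add: dist_commute[of "circle_point Q r (\<theta> + 2 * x)"] dist_circle_point)
  qed
  have d: "dist P A = 2 * r * sin \<alpha>" "dist P B = 2 * r * sin \<beta>" "dist P C = 2 * r * sin \<gamma>"
    "dist B C = 2 * r * sin (\<gamma> - \<beta>)" "dist C A = 2 * r * sin (\<gamma> - \<alpha>)"
    "dist A B = 2 * r * sin (\<alpha> - \<beta>)"
    using order dist[of 0 \<alpha>] dist[of 0 \<beta>] dist[of 0 \<gamma>] dist[of \<beta> \<gamma>] dist[of \<alpha> \<gamma>] dist[of \<beta> \<alpha>]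
    by (simp_all add: A B C P dist_commute)
  have "sin \<alpha> > 0" "sin \<gamma> > 0" using order by (auto intro!: sin_gt_zero)
  then have "dist P A \<noteq> 0" "dist P C \<noteq> 0" unfolding d using r by simp_all
  then show "P \<noteq> A" "P \<noteq> C" by auto
  show "dist P A * dist B C = dist P B * dist C A + dist P C * dist A B"
    unfolding d using ptolemy_sin(1)[of \<alpha> \<gamma> \<beta>] by algebra
  have "dist P A * (dist A B * dist P B + dist C A * dist P C) = (2 * r) ^ 3 *
      (sin \<alpha> * (sin (\<alpha> - \<beta>) * sin \<beta> + sin (\<gamma> - \<alpha>) * sin \<gamma>))"
    unfolding d by algebra
  also have "\<dots> = dist B C * (dist C A * dist A B + dist P B * dist P C)"
    unfolding d ptolemy_sin(2) by algebra
  finally show "dist P A * (dist A B * dist P B + dist C A * dist P C) =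
    dist B C * (dist C A * dist A B + dist P B * dist P C)" .
qed

section \<open>Reduction to one cyclic order of the corners\<close>

theorem proposition11:
  fixes A B C P Q :: "real^2" and r :: real
  assumes triangle: "\<not> collinear {A, B, C}"
    and circumcircle: "{A, B, C} \<subseteq> sphere Q r"
    and P_on: "P \<in> sphere Q r"
  shows "(\<exists>M. conic_matrix M \<and> six_vertices A B C P \<subseteq> conic_curve M) \<and>
    (\<forall>M. conic_matrix M \<and> six_vertices A B C P \<subseteq> conic_curve M \<longrightarrow>
       degenerate_conic M \<and>
       (\<exists>L1 L2. straight_line L1 \<and> straight_line L2 \<and> L1 \<noteq> L2 \<and> conic_curve M = L1 \<union> L2))"
proof -
  have ne: "A \<noteq> B" "B \<noteq> C" "C \<noteq> A"
    using triangle by (auto simp: insert_commute)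
  have "r \<noteq> 0" using circumcircle ne by auto
  then have r: "r > 0" using P_on by (auto simp: order_less_le)
  obtain \<theta> where P0: "P = circle_point Q r (0 + 2 * \<theta>)"
    using sphere_circle_point[OF P_on r] by blast
  then have P: "P = circle_point Q r (2 * \<theta>)" by simp
  obtain \<alpha> where \<alpha>: "0 \<le> \<alpha>" "\<alpha> < pi" "A = circle_point Q r (2 * \<theta> + 2 * \<alpha>)"
    using sphere_circle_point[of A Q r "2 * \<theta>"] circumcircle r by auto
  obtain \<beta> where \<beta>: "0 \<le> \<beta>" "\<beta> < pi" "B = circle_point Q r (2 * \<theta> + 2 * \<beta>)"
    using sphere_circle_point[of B Q r "2 * \<theta>"] circumcircle r by auto
  obtain \<gamma> where \<gamma>: "0 \<le> \<gamma>" "\<gamma> < pi" "C = circle_point Q r (2 * \<theta> + 2 * \<gamma>)"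
    using sphere_circle_point[of C Q r "2 * \<theta>"] circumcircle r by auto
  note main = only_line_pairs_ordered[OF _ r _ _ _ P]
  have perm: "\<not> collinear {B, C, A}" "\<not> collinear {C, A, B}" "\<not> collinear {A, C, B}"
    "\<not> collinear {B, A, C}" "\<not> collinear {C, B, A}"
    using triangle by (simp_all add: insert_commute)
  have perms: "six_vertices A C B P = six_vertices A B C P" "six_vertices B A C P = six_vertices A B C P"
    "six_vertices B C A P = six_vertices A B C P" "six_vertices C A B P = six_vertices A B C P"
    "six_vertices C B A P = six_vertices A B C P"
    unfolding six_vertices_def
    using P_ellipse_vertices_commute[of B C P] P_ellipse_vertices_commute[of C A P]
      P_ellipse_vertices_commute[of A B P] by auto
  have "\<alpha> \<noteq> \<beta>" "\<beta> \<noteq> \<gamma>" "\<gamma> \<noteq> \<alpha>" using ne \<alpha> \<beta> \<gamma> by auto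
  \<comment> \<open>The corner with the middle angle, opposite \<open>P\<close>, takes the role of
    \<open>A\<close>; the one with the smallest angle, which may be 0, takes the role of
    \<open>B\<close>.\<close>
  then consider "\<beta> < \<alpha>" "\<alpha> < \<gamma>" | "\<gamma> < \<alpha>" "\<alpha> < \<beta>" | "\<alpha> < \<beta>" "\<beta> < \<gamma>" | "\<gamma> < \<beta>" "\<beta> < \<alpha>"
    | "\<alpha> < \<gamma>" "\<gamma> < \<beta>" | "\<beta> < \<gamma>" "\<gamma> < \<alpha>"
    by linarith
  then show ?thesis
  proof cases
    case 1
    then show ?thesis by (rule main[OF triangle \<alpha>(3) \<beta>(3) \<gamma>(3) \<beta>(1) _ _ \<gamma>(2)])
  next
    case 2
    from main[OF perm(3) \<alpha>(3) \<gamma>(3) \<beta>(3) \<gamma>(1) 2 \<beta>(2)]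
    show ?thesis unfolding perms .
  next
    case 3
    from main[OF perm(4) \<beta>(3) \<alpha>(3) \<gamma>(3) \<alpha>(1) 3 \<gamma>(2)]
    show ?thesis unfolding perms .
  next
    case 4
    from main[OF perm(1) \<beta>(3) \<gamma>(3) \<alpha>(3) \<gamma>(1) 4 \<alpha>(2)]
    show ?thesis unfolding perms .
  next
    case 5
    from main[OF perm(2) \<gamma>(3) \<alpha>(3) \<beta>(3) \<alpha>(1) 5 \<beta>(2)]
    show ?thesis unfolding perms .
  next
    case 6
    from main[OF perm(5) \<gamma>(3) \<beta>(3) \<alpha>(3) \<beta>(1) 6 \<alpha>(2)]
    show ?thesis unfolding perms .
  qed
qed

end
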